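(* Let $n\in\mathbb{N}$ and let $E\subset\mathbb{R}^n$ be a nonempty set. Let $\alpha\in\mathbb{R}\setminus\{0\}$ and define $w(x)=\operatorname{dist}(x,E)^{-\alpha}$ for every $x\in\mathbb{R}^n$. Then $w\in A_1$ if and only if $0<\alpha<\operatorname{Mu}(E)$.
   Context: $|\cdot|$ is $n$-dimensional Lebesgue measure; $\operatorname{dist}(x,E)$ is the Euclidean distance; $B(x,r)$ is the open Euclidean ball. For $\alpha>0$, $\operatorname{dist}(x,E)^{-\alpha}=+\infty$ where $\operatorname{dist}(x,E)=0$. Muckenhoupt exponent: for a ball $B(x,r)$, $h_E(B(x,r))$ is the supremum of all $t>0$ such that $B(y,t)\subset B(x,r)\setminus E$ for some $y\in B(x,r)$, and $h_E(B(x,r))=0$ if there is no such $t$. Let $E_r=\{y\in\mathbb{R}^n:\operatorname{dist}(y,E)<r\}$. If $h_E(B(x,R))>0$ for every $x\in E$ and $R>0$, then $\operatorname{Mu}(E)$ is the supremum of the numbers $\alpha\in\mathbb{R}$ for which there is a constant $C$ such that $$\frac{|E_r\cap B(x,R)|}{|B(x,R)|}\le C\Bigl(\frac{h_E(B(x,R))}{r}\Bigr)^{-\alpha}$$ for every $x\in E$ and $0<r<h_E(B(x,R))\le R$. If $h_E(B(x,R))=0$ for some $x\in E$ and $R>0$, then $\operatorname{Mu}(E)=0$. A cube is a half-open set $[a_1,b_1)\times\cdots\times[a_n,b_n)$ with all sides of equal positive length. A weight is a locally integrable function $w$ on $\mathbb{R}^n$ with $w>0$ almost everywhere. A weight $w$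 is in $A_1$ if there is $C$ with $\frac1{|Q|}\int_Q w\,dx\le C\operatorname{ess\,inf}_{Q}w$ for every cube $Q\subset\mathbb{R}^n$. A function that is not a weight does not belong to $A_1$. *)

theory Defs
  imports "HOL-Analysis.Analysis"
begin

text \<open>
  Euclidean n-space is \<open>real ^ 'n\<close> with \<open>n = CARD('n) \<ge> 1\<close>; distances to a (nonempty) set
  are given by \<open>infdist\<close>.
\<close>

text \<open>
  \<open>max_hole E x R\<close> is $h_E(B(x,R))$. It is attached to the pair of centre and radius, which the
  ball determines. The set of admissible \<open>t\<close> is bounded above by \<open>R\<close>, so the real supremum is
  meaningful whenever the set is nonempty.
\<close>

definition hole_radii :: "(real ^ 'n) set \<Rightarrow> real ^ 'n \<Rightarrow> real \<Rightarrow> real set" where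
  "hole_radii E x R = {t. t > 0 \<and> (\<exists>y \<in> ball x R. ball y t \<subseteq> ball x R - E)}"

definition max_hole :: "(real ^ 'n) set \<Rightarrow> real ^ 'n \<Rightarrow> real \<Rightarrow> real" where
  "max_hole E x R = (if hole_radii E x R = {} then 0 else Sup (hole_radii E x R))"

definition open_nbhd :: "(real ^ 'n) set \<Rightarrow> real \<Rightarrow> (real ^ 'n) set" where
  "open_nbhd E r = {y. infdist y E < r}"

definition Mu_admissible :: "(real ^ 'n) set \<Rightarrow> real \<Rightarrow> bool" where
  "Mu_admissible E \<alpha> \<longleftrightarrow>
     (\<exists>C::real. \<forall>x\<in>E. \<forall>r R. 0 < r \<and> r < max_hole E x R \<and> max_hole E x R \<le> R \<longrightarrow>
        measure lebesgue (open_nbhd E r \<inter> ball x R) / measure lebesgue (ball x R)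
          \<le> C * (max_hole E x R / r) powr (- \<alpha>))"

text \<open>
  The supremum is taken in the extended reals, so that no boundedness or nonemptiness of the set of
  admissible exponents is built into the definition.
\<close>

definition Mu :: "(real ^ 'n) set \<Rightarrow> ereal" where
  "Mu E = (if \<forall>x\<in>E. \<forall>R>0. max_hole E x R > 0
           then Sup (ereal ` {\<alpha>. Mu_admissible E \<alpha>}) else 0)"

definition is_cube :: "(real ^ 'n) set \<Rightarrow> bool" where
  "is_cube Q \<longleftrightarrow> (\<exists>a l. l > 0 \<and> Q = {x. \<forall>i. a $ i \<le> x $ i \<and> x $ i < a $ i + l})"

text \<open>
  Weights take values in $[0,\infty]$, hence the type \<open>ennreal\<close>; measurability is with respect to
  the Lebesgue (not just Borel) sets.
\<close>

definition locally_integrable :: "(real ^ 'n \<Rightarrow> ennreal) \<Rightarrow> bool" where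
  "locally_integrable w \<longleftrightarrow> w \<in> borel_measurable lebesgue \<and>
     (\<forall>K. compact K \<longrightarrow> (\<integral>\<^sup>+x\<in>K. w x \<partial>lebesgue) < \<infinity>)"

definition weight :: "(real ^ 'n \<Rightarrow> ennreal) \<Rightarrow> bool" where
  "weight w \<longleftrightarrow> locally_integrable w \<and> (AE x in lebesgue. w x > 0)"

definition essinf_on :: "(real ^ 'n) set \<Rightarrow> (real ^ 'n \<Rightarrow> ennreal) \<Rightarrow> ennreal" where
  "essinf_on Q w = Sup {c. AE x in lebesgue. x \<in> Q \<longrightarrow> c \<le> w x}"

definition A1 :: "(real ^ 'n \<Rightarrow> ennreal) set" where
  "A1 = {w. weight w \<and>
     (\<exists>C::real. \<forall>Q. is_cube Q \<longrightarrow>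
        (\<integral>\<^sup>+x\<in>Q. w x \<partial>lebesgue) / emeasure lebesgue Q \<le> ennreal C * essinf_on Q w)}"

text \<open>
  The function $\mathrm{dist}(x,E)^{-\alpha}$. The value at distance zero is $\infty$ for
  \<open>\<alpha> > 0\<close>, which \<open>powr\<close> would not give; for \<open>\<alpha> < 0\<close> it is \<open>0\<close>, as \<open>0 powr (- \<alpha>) = 0\<close>.
\<close>

definition dist_weight :: "(real ^ 'n) set \<Rightarrow> real \<Rightarrow> real ^ 'n \<Rightarrow> ennreal" where
  "dist_weight E \<alpha> x =
     (if \<alpha> > 0 \<and> infdist x E = 0 then \<infinity> else ennreal (infdist x E powr (- \<alpha>)))"

end

theory Submission
  imports Defs
begin

text \<open>
  Let \<open>w\<close> be the distance to \<open>E\<close> raised to the power \<open>- \<alpha>\<close>, and write \<open>E\<^sub>s\<close> for the open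
  \<open>s\<close>-neighbourhood of \<open>E\<close>. A negative \<open>\<alpha>\<close> is impossible, because \<open>w\<close> is then a continuous
  function that vanishes on \<open>E\<close>: its essential infimum over a cube with a corner in \<open>E\<close> is \<open>0\<close>,
  and the \<open>A\<^sub>1\<close> inequality would make \<open>w\<close> vanish almost everywhere on that cube
  (\<open>dist_weight_neg_notin_A1\<close>).

  Let \<open>\<alpha> > 0\<close>. If \<open>\<alpha> < Mu E\<close>, some \<open>\<beta> > \<alpha>\<close> is admissible. Cutting a ball around a point of
  \<open>E\<close> into dyadic shells of the distance function, the gap between \<open>\<alpha>\<close> and \<open>\<beta>\<close> turns the measure
  bound into a geometric series, so the mean of \<open>w\<close> over the ball is at most a constant times
  \<open>h\<close> to the power \<open>- \<alpha>\<close>, where \<open>h\<close> is the radius of the largest hole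
  (\<open>admissible_ball_bound\<close>). A cube close to \<open>E\<close> lies in such a ball, and a
  point of the cube at distance \<open>t\<close> from \<open>E\<close> is the centre of a hole of radius \<open>t\<close>, so that
  \<open>w\<close> is at least \<open>h\<close> to the power \<open>- \<alpha>\<close> on the cube. On a cube far from \<open>E\<close> the distance is
  constant up to a factor (\<open>admissible_imp_A1\<close>).

  Conversely let \<open>w \<in> A\<^sub>1\<close>. Comparing the mean of \<open>w\<close> with its value in the largest hole shows at
  once that \<open>\<alpha>\<close> is admissible, hence \<open>\<alpha> \<le> Mu E\<close>. The strict inequality needs a
  self-improvement, in the spirit of the reverse Hoelder inequality. Fix a cube \<open>Q\<close> that contains a
  point at distance at least \<open>s\<close> from \<open>E\<close>, and let \<open>V(s) = |Q \<inter> E\<^sub>s|\<close> and \<open>F(s)\<close> be the integral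
  of \<open>w\<close> over \<open>Q \<inter> E\<^sub>s\<close>. Stopping the dyadic subdivision of \<open>Q\<close> as soon as a subcube is contained
  in \<open>E\<^sub>s\<close> gives cubes whose parents still contain a point at distance at least \<open>s\<close>, and
  the \<open>A\<^sub>1\<close> condition on the parents yields \<open>F(s) \<le> M s\<^sup>-\<^sup>\<alpha> V(s)\<close> (\<open>level_set_bound\<close>). As
  \<open>w > s\<^sup>-\<^sup>\<alpha>\<close> on \<open>E\<^sub>s\<close>, this is a reverse inequality, and it forces \<open>F\<close> to decay like a positive power
  of \<open>s\<close> (\<open>self_improving_decay\<close>). That power is the gain which makes an exponent larger than
  \<open>\<alpha>\<close> admissible (\<open>A1_imp_larger_admissible\<close>).
\<close>

section \<open>Half-open cubes and their dyadic children\<close>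

definition cube :: "real ^ 'n \<Rightarrow> real \<Rightarrow> (real ^ 'n) set" where
  "cube a l = {x. \<forall>i. a $ i \<le> x $ i \<and> x $ i < a $ i + l}"

lemma is_cube_iff: "is_cube Q \<longleftrightarrow> (\<exists>a l. l > 0 \<and> Q = cube a l)"
  by (simp add: is_cube_def cube_def)

lemma cube_borel [measurable]: "cube a l \<in> sets borel"
proof -
  have "cube a l = (\<Inter>i\<in>UNIV. {x. a $ i \<le> x $ i} \<inter> {x. x $ i < a $ i + l})"
    unfolding cube_def by auto
  moreover have "{x. a $ i \<le> x $ i} \<in> sets borel" "{x. x $ i < a $ i + l} \<in> sets borel" for i
    using closed_halfspace_component_ge_cart[of "a $ i" i] open_halfspace_component_lt_cart[of i "a $ i + l"]
    by auto
  ultimately show ?thesis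
    by (simp add: sets.Int sets.finite_INT)
qed

lemma cube_lebesgue [simp]: "cube a l \<in> sets lebesgue"
  using cube_borel by (metis sets_completionI_sets sets_lborel)

lemma emeasure_cube:
  fixes a :: "real ^ 'n" and l :: real
  assumes "l > 0"
  shows "emeasure lebesgue (cube a l) = ennreal (l ^ CARD('n))"
proof -
  let ?b = "a + (\<chi> i. l)"
  have ab: "\<forall>b\<in>Basis. a \<bullet> b \<le> ?b \<bullet> b"
    using assms by (auto simp: Basis_vec_def inner_axis)
  have "cbox a ?b \<noteq> {}"
    using ab by (simp add: box_ne_empty)
  then have c: "measure lborel (cbox a ?b) = l ^ CARD('n)"
    by (simp add: content_cbox_cart)
  then have p: "(\<Prod>b\<in>Basis. (?b - a) \<bullet> b) = l ^ CARD('n)"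
    using ab by (simp add: measure_lborel_cbox_eq)
  have b: "emeasure lebesgue (box a ?b) = ennreal (l ^ CARD('n))"
    using ab p by (simp add: emeasure_lborel_box_eq)
  have b': "emeasure lebesgue (cbox a ?b) = ennreal (l ^ CARD('n))"
    using ab p by (simp add: emeasure_lborel_cbox_eq)
  have "box a ?b \<subseteq> cube a l" "cube a l \<subseteq> cbox a ?b"
    by (auto simp: cube_def mem_box_cart less_imp_le)
  then have "emeasure lebesgue (box a ?b) \<le> emeasure lebesgue (cube a l)" "emeasure lebesgue (cube a l) \<le> emeasure lebesgue (cbox a ?b)"
    by (auto intro!: emeasure_mono)
  then show ?thesis using b b' by simp
qed

lemma cube_dist_le:
  fixes x y :: "real ^ 'n" and l :: real
  assumes "x \<in> cube a l" "y \<in> cube a l"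
  shows "dist x y \<le> CARD('n) * l"
proof -
  have "dist x y \<le> (\<Sum>i\<in>UNIV. \<bar>(x - y) $ i\<bar>)"
    unfolding dist_norm by (rule norm_le_l1_cart)
  also have "\<dots> \<le> (\<Sum>i\<in>(UNIV :: 'n set). l :: real)"
  proof (rule sum_mono)
    fix i
    have "a $ i \<le> x $ i" "x $ i < a $ i + l" "a $ i \<le> y $ i" "y $ i < a $ i + l"
      using assms by (auto simp: cube_def)
    then show "\<bar>(x - y) $ i\<bar> \<le> l" by simp
  qed
  finally show ?thesis by simp
qed

text \<open>The \<open>2\<^sup>n\<close> dyadic children are indexed by the set \<open>S\<close> of coordinates in which the upper half
  is taken.\<close>

definition subcube :: "real ^ 'n \<Rightarrow> real \<Rightarrow> 'n set \<Rightarrow> (real ^ 'n) set" where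
  "subcube a l S = cube (\<chi> i. a $ i + (if i \<in> S then l / 2 else 0)) (l / 2)"

lemma subcube_iff:
  "x \<in> subcube a l S \<longleftrightarrow> (\<forall>i. if i \<in> S then a $ i + l / 2 \<le> x $ i \<and> x $ i < a $ i + l
        else a $ i \<le> x $ i \<and> x $ i < a $ i + l / 2)"
  unfolding subcube_def cube_def by (auto simp: field_simps split: if_splits)

lemma Union_subcube:
  fixes l :: real
  assumes "l > 0"
  shows "(\<Union>S. subcube a l S) = cube a l"
proof (intro set_eqI iffI)
  fix x assume "x \<in> (\<Union>S. subcube a l S)"
  then obtain S where S: "x \<in> subcube a l S" by auto
  show "x \<in> cube a l"
    unfolding cube_def mem_Collect_eq
  proof
    fix i show "a $ i \<le> x $ i \<and> x $ i < a $ i + l"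
      using S[unfolded subcube_iff, rule_format, of i] assms by (auto split: if_splits)
  qed
next
  fix x assume x: "x \<in> cube a l"
  have "x \<in> subcube a l {i. a $ i + l / 2 \<le> x $ i}"
    unfolding subcube_iff using x by (auto simp: cube_def)
  then show "x \<in> (\<Union>S. subcube a l S)" by blast
qed

lemma disjoint_subcube: "disjoint_family (subcube a l)"
  unfolding disjoint_family_on_def
proof (intro ballI impI equals0I)
  fix S T x assume "S \<noteq> T" and x: "x \<in> subcube a l S \<inter> subcube a l T"
  then obtain i where "i \<in> S \<longleftrightarrow> i \<notin> T" by blast
  moreover from x have "x \<in> subcube a l S" "x \<in> subcube a l T" by auto
  ultimately show False
    unfolding subcube_iff by (smt (verit))
qed

section \<open>The distance weight and its essential infimum\<close>

lemma open_nbhd_lebesgue [simp]: "open_nbhd E r \<in> sets lebesgue"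
proof -
  have "open (open_nbhd E r)"
    unfolding open_nbhd_def by (intro open_Collect_less continuous_intros)
  then show ?thesis by simp
qed

lemma dist_weight_measurable [measurable]:
  "dist_weight E \<alpha> \<in> borel_measurable lebesgue"
proof -
  have "(\<lambda>x. infdist x E) \<in> borel_measurable borel"
    by (intro borel_measurable_continuous_onI continuous_intros)
  then have "dist_weight E \<alpha> \<in> borel_measurable borel"
    unfolding dist_weight_def[abs_def] by measurable
  then show ?thesis
    by (metis measurable_completion measurable_lborel2)
qed

text \<open>Cubes serve as test sets for almost-everywhere statements, since they have positive
  measure.\<close>

lemma AE_cube_ex:
  fixes y :: "real ^ 'n" and s :: real
  assumes "AE x in lebesgue. P x" "s > 0"
  shows "\<exists>z\<in>cube y s. P z"
proof (rule ccontr)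
  assume no: "\<not> (\<exists>z\<in>cube y s. P z)"
  obtain N where N: "{x \<in> space lebesgue. \<not> P x} \<subseteq> N" "N \<in> sets lebesgue" "emeasure lebesgue N = 0"
    using assms(1) by (auto elim: AE_E)
  have "emeasure lebesgue (cube y s) \<le> emeasure lebesgue N"
    using N no by (intro emeasure_mono) auto
  then show False
    using N emeasure_cube[OF assms(2), of y] assms(2) by simp
qed

text \<open>Each point of a half-open cube, boundary points included, is the corner of a small cube that
  stays inside. So a value of a continuous function at any single point of the cube controls its
  essential infimum over the cube.\<close>

lemma subcube_near:
  fixes y :: "real ^ 'n" and l \<epsilon> :: real
  assumes "y \<in> cube a l" "\<epsilon> > 0"
  obtains s where "s > 0" "cube y s \<subseteq> cube a l \<inter> ball y \<epsilon>"
proof -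
  \<comment> \<open>The small side must fit below each upper face, and \<open>n\<close> times it bounds the diameter.\<close>
  define T where "T = insert (\<epsilon> / (2 * CARD('n))) (range (\<lambda>i. a $ i + l - y $ i))"
  have T: "finite T" "T \<noteq> {}" unfolding T_def by auto
  have pos: "Min T > 0"
    using assms unfolding Min_gr_iff[OF T] by (auto simp: T_def cube_def)
  have le: "Min T \<le> a $ i + l - y $ i" for i
    by (intro Min_le T) (auto simp: T_def)
  have le': "Min T \<le> \<epsilon> / (2 * CARD('n))"
    by (intro Min_le T) (auto simp: T_def)
  have "x \<in> cube a l \<inter> ball y \<epsilon>" if x: "x \<in> cube y (Min T)" for x
  proof
    show "x \<in> cube a l"
      unfolding cube_def mem_Collect_eq
    proof
      fix i show "a $ i \<le> x $ i \<and> x $ i < a $ i + l"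
        using x assms(1) le[of i] unfolding cube_def by (smt (verit) mem_Collect_eq)
    qed
    have "y \<in> cube y (Min T)" using pos by (simp add: cube_def)
    then have "dist y x \<le> CARD('n) * Min T" using x by (rule cube_dist_le)
    also have "\<dots> \<le> \<epsilon> / 2" using le' by (simp add: field_simps)
    finally show "x \<in> ball y \<epsilon>" using assms(2) by simp
  qed
  then show thesis using pos that by blast
qed

lemma essinf_cube_le:
  fixes E :: "(real ^ 'n) set" and l r \<alpha> :: real
  assumes "\<alpha> > 0" "y \<in> cube a l" "r > 0" "r \<le> infdist y E"
  shows "essinf_on (cube a l) (dist_weight E \<alpha>) \<le> ennreal ((r / 2) powr (- \<alpha>))"
  unfolding essinf_on_def
proof (rule Sup_least)
  fix c assume "c \<in> {c. AE x in lebesgue. x \<in> cube a l \<longrightarrow> c \<le> dist_weight E \<alpha> x}"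
  then have c: "AE x in lebesgue. x \<in> cube a l \<longrightarrow> c \<le> dist_weight E \<alpha> x" by simp
  obtain s where s: "s > 0" "cube y s \<subseteq> cube a l \<inter> ball y (r / 2)"
    using subcube_near[OF assms(2), of "r / 2"] assms(3) by auto
  obtain z where z: "z \<in> cube y s" "z \<in> cube a l \<longrightarrow> c \<le> dist_weight E \<alpha> z"
    using AE_cube_ex[OF c s(1)] by blast
  have "r / 2 \<le> infdist z E"
    using s z assms(3,4) infdist_triangle[of y E z] by (auto simp: subset_iff)
  then have "dist_weight E \<alpha> z \<le> ennreal ((r / 2) powr (- \<alpha>))"
    using assms(1,3) unfolding dist_weight_def
    by (auto intro!: ennreal_leI powr_mono2')
  then show "c \<le> ennreal ((r / 2) powr (- \<alpha>))"
    using z s by (meson IntD1 order_trans subsetD)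
qed

section \<open>A stopping-time estimate for neighbourhoods\<close>

text \<open>
  The stopping-time argument in inductive form. The radius is lowered by the diameter bound of
  the cubes reached after \<open>k\<close> halvings. A child contained in the \<open>r\<close>-neighbourhood is a
  stopped cube: the hypothesis on its parent bounds \<open>\<nu>\<close> there, at the price of the volume ratio
  \<open>2\<^sup>n\<close>. Any other child contains a point at distance at least \<open>r\<close> and falls under the induction
  hypothesis. A cube that is still undecided at the end does not meet the smaller neighbourhood.
\<close>

lemma level_set_bound_depth:
  fixes E :: "(real ^ 'n) set" and l r A :: real
  assumes sets: "sets \<nu> = sets lebesgue"
    and bound: "\<And>a (l::real) y. l > 0 \<Longrightarrow> y \<in> cube a l \<Longrightarrow> r \<le> infdist y E
                  \<Longrightarrow> emeasure \<nu> (cube a l) \<le> ennreal (A * l ^ CARD('n))"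
    and "A \<ge> 0"
  shows "\<lbrakk>l > 0; y \<in> cube a l; r \<le> infdist y E\<rbrakk> \<Longrightarrow>
     emeasure \<nu> (cube a l \<inter> open_nbhd E (r - CARD('n) * l / 2 ^ k))
       \<le> ennreal (2 ^ CARD('n) * A) * emeasure lebesgue (cube a l \<inter> open_nbhd E r)"
proof (induction k arbitrary: a l y)
  case 0
  have "cube a l \<inter> open_nbhd E (r - CARD('n) * l / 2 ^ 0) = {}"
  proof (intro equals0I)
    fix x assume "x \<in> cube a l \<inter> open_nbhd E (r - CARD('n) * l / 2 ^ 0)"
    then show False
      using 0 infdist_triangle[of y E x] cube_dist_le[of y a l x] by (auto simp: open_nbhd_def)
  qed
  then show ?case by simp
next
  case (Suc k)
  let ?\<epsilon> = "CARD('n) * l / 2 ^ Suc k"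
  have eps: "?\<epsilon> = CARD('n) * (l / 2) / 2 ^ k" by simp
  have U: "cube a l \<inter> X = (\<Union>S. subcube a l S \<inter> X)" for X
    using Union_subcube[OF Suc.prems(1), of a] by auto
  have meas: "subcube a l S \<inter> open_nbhd E t \<in> sets lebesgue" for S t
    by (auto simp: subcube_def)
  have disj: "disjoint_family (\<lambda>S. subcube a l S \<inter> open_nbhd E t)" for t
    using disjoint_subcube[of a l] by (auto simp: disjoint_family_on_def)
  have step: "emeasure \<nu> (subcube a l S \<inter> open_nbhd E (r - ?\<epsilon>))
      \<le> ennreal (2 ^ CARD('n) * A) * emeasure lebesgue (subcube a l S \<inter> open_nbhd E r)" for S
  proof (cases "\<exists>y'\<in>subcube a l S. r \<le> infdist y' E")
    case True
    then obtain y' where y': "y' \<in> subcube a l S" "r \<le> infdist y' E" by blast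
    show ?thesis
      unfolding eps subcube_def
      by (rule Suc.IH[OF _ y'(1)[unfolded subcube_def] y'(2)]) (use Suc.prems(1) in simp)
  next
    case False
    then have sub: "subcube a l S \<inter> open_nbhd E r = subcube a l S"
      by (auto simp: open_nbhd_def not_le)
    have "emeasure \<nu> (subcube a l S \<inter> open_nbhd E (r - ?\<epsilon>)) \<le> emeasure \<nu> (cube a l)"
      using Union_subcube[OF Suc.prems(1), of a] by (intro emeasure_mono) (auto simp: sets)
    also have "\<dots> \<le> ennreal (A * l ^ CARD('n))"
      by (rule bound[OF Suc.prems])
    also have "\<dots> = ennreal (2 ^ CARD('n) * A) * ennreal ((l / 2) ^ CARD('n))"
      using assms(3) Suc.prems(1) by (simp add: ennreal_mult[symmetric] power_divide)
    also have "ennreal ((l / 2) ^ CARD('n)) = emeasure lebesgue (subcube a l S)"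
      unfolding subcube_def using Suc.prems(1) by (subst emeasure_cube) auto
    finally show ?thesis unfolding sub .
  qed
  have "emeasure \<nu> (cube a l \<inter> open_nbhd E (r - ?\<epsilon>))
      = (\<Sum>S\<in>UNIV. emeasure \<nu> (subcube a l S \<inter> open_nbhd E (r - ?\<epsilon>)))"
    unfolding U using meas disj sets by (intro sum_emeasure[symmetric]) auto
  also have "\<dots> \<le> (\<Sum>S\<in>UNIV. ennreal (2 ^ CARD('n) * A) * emeasure lebesgue (subcube a l S \<inter> open_nbhd E r))"
    by (intro sum_mono step)
  also have "\<dots> = ennreal (2 ^ CARD('n) * A) * (\<Sum>S\<in>UNIV. emeasure lebesgue (subcube a l S \<inter> open_nbhd E r))"
    by (simp add: sum_distrib_left)
  also have "(\<Sum>S\<in>UNIV. emeasure lebesgue (subcube a l S \<inter> open_nbhd E r)) = emeasure lebesgue (cube a l \<inter> open_nbhd E r)"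
    unfolding U using meas disj by (intro sum_emeasure) auto
  finally show ?case .
qed

text \<open>Infinite depth exhausts the whole \<open>r\<close>-neighbourhood.\<close>

lemma level_set_bound:
  fixes E :: "(real ^ 'n) set" and l r A :: real
  assumes sets: "sets \<nu> = sets lebesgue"
    and bound: "\<And>a (l::real) y. l > 0 \<Longrightarrow> y \<in> cube a l \<Longrightarrow> r \<le> infdist y E
                  \<Longrightarrow> emeasure \<nu> (cube a l) \<le> ennreal (A * l ^ CARD('n))"
    and "A \<ge> 0" "l > 0" "y \<in> cube a l" "r \<le> infdist y E"
  shows "emeasure \<nu> (cube a l \<inter> open_nbhd E r)
       \<le> ennreal (2 ^ CARD('n) * A) * emeasure lebesgue (cube a l \<inter> open_nbhd E r)"
proof -
  define B where "B k = cube a l \<inter> open_nbhd E (r - CARD('n) * l / 2 ^ k)" for k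
  have mono: "incseq B"
  proof (rule incseq_SucI)
    fix k
    have "CARD('n) * l / 2 ^ Suc k \<le> CARD('n) * l / 2 ^ k"
      using assms(4) by (intro divide_left_mono mult_nonneg_nonneg) auto
    then show "B k \<le> B (Suc k)" unfolding B_def open_nbhd_def by auto
  qed
  have "(\<Union>k. B k) = cube a l \<inter> open_nbhd E r"
  proof (intro set_eqI iffI)
    fix x assume "x \<in> (\<Union>k. B k)"
    then obtain k where "x \<in> B k" by blast
    moreover have "CARD('n) * l / 2 ^ k \<ge> 0" using assms(4) by simp
    ultimately show "x \<in> cube a l \<inter> open_nbhd E r"
      unfolding B_def open_nbhd_def by auto
  next
    fix x assume x: "x \<in> cube a l \<inter> open_nbhd E r"
    have "(\<lambda>k. r - CARD('n) * l * (1 / 2) ^ k) \<longlonglongrightarrow> r - CARD('n) * l * 0"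
      by (intro tendsto_intros LIMSEQ_power_zero) auto
    then have "\<forall>\<^sub>F k in sequentially. infdist x E < r - CARD('n) * l * (1 / 2) ^ k"
      using x by (intro order_tendstoD(1)) (auto simp: open_nbhd_def)
    then obtain k where "infdist x E < r - CARD('n) * l * (1 / 2) ^ k"
      by (auto simp: eventually_sequentially)
    then have "x \<in> B k" using x by (simp add: B_def open_nbhd_def power_divide)
    then show "x \<in> (\<Union>k. B k)" by blast
  qed
  moreover have "range B \<subseteq> sets \<nu>"
    unfolding sets B_def by (intro image_subsetI sets.Int) simp_all
  then have "(SUP k. emeasure \<nu> (B k)) = emeasure \<nu> (\<Union>k. B k)"
    using mono by (rule SUP_emeasure_incseq)
  moreover have "(SUP k. emeasure \<nu> (B k))
      \<le> ennreal (2 ^ CARD('n) * A) * emeasure lebesgue (cube a l \<inter> open_nbhd E r)"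
    unfolding B_def by (intro SUP_least level_set_bound_depth[OF assms])
  ultimately show ?thesis by simp
qed

section \<open>Self-improvement of a reverse inequality\<close>

lemma power_powr_swap:
  fixes a b :: real
  assumes "a > 0"
  shows "(a ^ k) powr b = (a powr b) ^ k"
  using assms by (simp add: powr_realpow[symmetric] powr_powr mult.commute)

lemma geometric_bracket:
  fixes K d s :: real
  assumes "K > 1" "0 < d" "d < s"
  obtains k where "s / K ^ Suc k \<le> d" "d < s / K ^ k"
proof -
  define P where "P k \<longleftrightarrow> s / K ^ k \<le> d" for k :: nat
  obtain m where "(1 / K) ^ m < d / s"
    using real_arch_pow_inv[of "d / s" "1 / K"] assms by auto
  then have "P m" using assms by (simp add: P_def field_simps power_divide)
  moreover have "\<not> P 0" using assms by (simp add: P_def)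
  ultimately obtain k where "\<not> P k" "P (Suc k)"
    using ex_least_nat_less[of P m] by (metis less_Suc_eq_0_disj not_less_eq lessI le_refl)
  then show thesis using that by (auto simp: P_def not_le)
qed

text \<open>
  Here \<open>V\<close> and \<open>F\<close> stand for the measure and the weighted measure of the \<open>s\<close>-neighbourhood inside a
  fixed cube. Passing from \<open>s\<close> to \<open>s / K\<close> multiplies the lower bound for the weight by
  \<open>K\<close> to the power \<open>\<alpha>\<close>, so the reverse inequality forces \<open>V(s / K)\<close> to be at most half of \<open>V(s)\<close> once
  that factor is \<open>2 M\<close>. The shell between the two neighbourhoods then carries half
  of \<open>V(s)\<close>, and thus, again by the reverse inequality, a fixed fraction \<open>1 / (2 M)\<close> of \<open>F(s)\<close>.
  Hence \<open>F(s / K) \<le> \<theta> F(s)\<close> with \<open>\<theta> < 1\<close>, and iteration gives a power. The constants depend on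
  \<open>M\<close> and \<open>\<alpha>\<close> only, which is what makes the later estimate uniform over all balls.
\<close>

lemma self_improving_decay:
  fixes M \<alpha> :: real
  assumes "M \<ge> 1" "\<alpha> > 0"
  obtains \<delta> c where "\<delta> > 0" "c > 0"
    "\<And>V F s\<^sub>0 r. \<lbrakk>\<And>r s. 0 < r \<Longrightarrow> r \<le> s \<Longrightarrow> s \<le> s\<^sub>0 \<Longrightarrow> V r \<le> V s;
        \<And>r. 0 < r \<Longrightarrow> r \<le> s\<^sub>0 \<Longrightarrow> r powr (- \<alpha>) * V r \<le> F r;
        \<And>r s. 0 < r \<Longrightarrow> r \<le> s \<Longrightarrow> s \<le> s\<^sub>0 \<Longrightarrow> s powr (- \<alpha>) * (V s - V r) \<le> F s - F r;
        \<And>s. 0 < s \<Longrightarrow> s \<le> s\<^sub>0 \<Longrightarrow> F s \<le> M * (s powr (- \<alpha>) * V s);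
        0 \<le> F s\<^sub>0; 0 < r; r < s\<^sub>0\<rbrakk>
      \<Longrightarrow> F r \<le> c * (r / s\<^sub>0) powr \<delta> * (F s\<^sub>0 :: real)"
proof -
  define K where "K = (2 * M) powr (1 / \<alpha>)"
  define \<theta> where "\<theta> = 1 - 1 / (2 * M)"
  define \<delta> where "\<delta> = - ln \<theta> / ln K"
  have K: "K > 1" unfolding K_def using assms by (intro gr_one_powr) auto
  have K\<alpha>: "K powr \<alpha> = 2 * M" using assms by (simp add: K_def powr_powr)
  have \<theta>: "0 < \<theta>" "\<theta> < 1" using assms by (auto simp: \<theta>_def field_simps)
  have \<delta>: "\<delta> > 0" unfolding \<delta>_def using \<theta> K by (simp add: divide_neg_pos)
  have K\<delta>: "K powr (- \<delta>) = \<theta>"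
    using K \<theta> by (simp add: \<delta>_def powr_def)
  show thesis
  proof (rule that[OF \<delta>, of "1 / \<theta>"])
    fix V F :: "real \<Rightarrow> real" and s0 r :: real
    assume mono: "\<And>r s. 0 < r \<Longrightarrow> r \<le> s \<Longrightarrow> s \<le> s0 \<Longrightarrow> V r \<le> V s"
      and lower: "\<And>r. 0 < r \<Longrightarrow> r \<le> s0 \<Longrightarrow> r powr (- \<alpha>) * V r \<le> F r"
      and shell: "\<And>r s. 0 < r \<Longrightarrow> r \<le> s \<Longrightarrow> s \<le> s0 \<Longrightarrow> s powr (- \<alpha>) * (V s - V r) \<le> F s - F r"
      and upper: "\<And>s. 0 < s \<Longrightarrow> s \<le> s0 \<Longrightarrow> F s \<le> M * (s powr (- \<alpha>) * V s)"
      and "0 \<le> F s0" and r: "0 < r" "r < s0"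
    have Fmono: "F p \<le> F q" if "0 < p" "p \<le> q" "q \<le> s0" for p q
    proof -
      have "0 \<le> q powr (- \<alpha>) * (V q - V p)" using mono[OF that] by simp
      then show ?thesis using shell[OF that] by linarith
    qed
    have step: "F (s / K) \<le> \<theta> * F s" if s: "0 < s" "s \<le> s0" for s
    proof -
      have "s / K \<le> s" using s K mult_right_mono[of 1 K s] by (auto simp: field_simps)
      then have sK: "0 < s / K" "s / K \<le> s" "s / K \<le> s0" using s K by auto
      define g where "g = s powr (- \<alpha>)"
      have g: "g > 0" using s by (simp add: g_def)
      have "(s / K) powr (- \<alpha>) = 2 * M * g"
        using s K K\<alpha> by (simp add: g_def powr_divide powr_minus field_simps)
      then have "2 * M * g * V (s / K) \<le> F (s / K)" using lower[of "s / K"] sK by simp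
      also have "\<dots> \<le> F s" using Fmono sK s by simp
      also have "\<dots> \<le> M * (g * V s)" using upper[OF s] by (simp add: g_def)
      finally have "(M * g) * (2 * V (s / K)) \<le> (M * g) * V s" by (simp add: algebra_simps)
      then have "2 * V (s / K) \<le> V s" using g assms by simp
      then have "g * V s / 2 \<le> g * (V s - V (s / K))" using g by (simp add: field_simps)
      also have "\<dots> \<le> F s - F (s / K)" using shell[of "s / K" s] sK s by (simp add: g_def)
      finally have "F (s / K) \<le> F s - g * V s / 2" by simp
      also have "\<dots> \<le> F s - F s / (2 * M)"
        using upper[OF s] assms by (simp add: g_def field_simps)
      finally show ?thesis by (simp add: \<theta>_def algebra_simps)
    qed
    have iter: "F (s0 / K ^ k) \<le> \<theta> ^ k * F s0" for k
    proof (induction k)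
      case (Suc k)
      have "s0 / K ^ k \<le> s0 / 1" using K r by (intro divide_left_mono) auto
      then have "F (s0 / K ^ k / K) \<le> \<theta> * F (s0 / K ^ k)" using K r by (intro step) auto
      also have "\<dots> \<le> \<theta> * (\<theta> ^ k * F s0)" using Suc \<theta> by simp
      finally show ?case by (simp add: mult_ac)
    qed simp
    obtain k where k: "s0 / K ^ Suc k \<le> r" "r < s0 / K ^ k"
      using geometric_bracket[OF K r] .
    have "s0 / K ^ k \<le> s0 / 1" using K r by (intro divide_left_mono) auto
    then have "F r \<le> F (s0 / K ^ k)" using Fmono r k by simp
    also have "\<dots> \<le> \<theta> ^ k * F s0" by (rule iter)
    also have "\<theta> ^ k = 1 / \<theta> * (1 / K ^ Suc k) powr \<delta>"
    proof -
      have "(1 / K ^ Suc k) powr \<delta> = (K powr (- \<delta>)) ^ Suc k"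
        using K power_powr_swap[of K "Suc k" "- \<delta>"] by (simp add: powr_divide powr_minus field_simps)
      then show ?thesis unfolding K\<delta> using \<theta> by simp
    qed
    also have "1 / \<theta> * (1 / K ^ Suc k) powr \<delta> * F s0 \<le> 1 / \<theta> * (r / s0) powr \<delta> * F s0"
      using \<theta> \<delta> K k r \<open>F s0 \<ge> 0\<close>
      by (intro mult_right_mono mult_left_mono powr_mono2) (auto simp: field_simps)
    finally show "F r \<le> 1 / \<theta> * (r / s0) powr \<delta> * F s0" .
  qed (use \<theta> in auto)
qed

section \<open>The weighted measure and holes\<close>

text \<open>Treating \<open>A \<mapsto> \<integral>\<^sub>A w\<close> as a measure makes additivity, monotonicity and continuity from below
  available for the set integrals of the weight.\<close>

definition dist_measure :: "(real ^ 'n) set \<Rightarrow> real \<Rightarrow> (real ^ 'n) measure" where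
  "dist_measure E \<alpha> = density lebesgue (dist_weight E \<alpha>)"

lemma sets_dist_measure [simp]: "sets (dist_measure E \<alpha>) = sets lebesgue"
  by (simp add: dist_measure_def)

lemma emeasure_dist_measure:
  "A \<in> sets lebesgue \<Longrightarrow> emeasure (dist_measure E \<alpha>) A = (\<integral>\<^sup>+x\<in>A. dist_weight E \<alpha> x \<partial>lebesgue)"
  unfolding dist_measure_def by (rule emeasure_density) simp_all

lemma dist_measure_ge:
  assumes "A \<in> sets lebesgue" "A \<subseteq> open_nbhd E s" "s > 0" "\<alpha> > 0"
  shows "ennreal (s powr (- \<alpha>)) * emeasure lebesgue A \<le> emeasure (dist_measure E \<alpha>) A"
proof -
  have "ennreal (s powr (- \<alpha>)) * emeasure lebesgue A = (\<integral>\<^sup>+x. ennreal (s powr (- \<alpha>)) * indicator A x \<partial>lebesgue)"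
    using assms(1) by (simp add: nn_integral_cmult_indicator)
  also have "\<dots> \<le> (\<integral>\<^sup>+x\<in>A. dist_weight E \<alpha> x \<partial>lebesgue)"
  proof (rule nn_integral_mono)
    fix x show "ennreal (s powr (- \<alpha>)) * indicator A x \<le> dist_weight E \<alpha> x * indicator A x"
    proof (cases "x \<in> A")
      case True
      then have "infdist x E < s" using assms(2) by (auto simp: open_nbhd_def)
      then show ?thesis
        using True assms(3,4) infdist_nonneg[of x E] unfolding dist_weight_def
        by (auto intro!: ennreal_leI powr_mono2')
    qed simp
  qed
  finally show ?thesis using assms(1) by (simp add: emeasure_dist_measure)
qed

lemma dist_measure_le:
  assumes "A \<in> sets lebesgue" "A \<inter> open_nbhd E s = {}" "s > 0" "\<alpha> > 0"
  shows "emeasure (dist_measure E \<alpha>) A \<le> ennreal (s powr (- \<alpha>)) * emeasure lebesgue A"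
proof -
  have "(\<integral>\<^sup>+x\<in>A. dist_weight E \<alpha> x \<partial>lebesgue) \<le> (\<integral>\<^sup>+x. ennreal (s powr (- \<alpha>)) * indicator A x \<partial>lebesgue)"
  proof (rule nn_integral_mono)
    fix x show "dist_weight E \<alpha> x * indicator A x \<le> ennreal (s powr (- \<alpha>)) * indicator A x"
    proof (cases "x \<in> A")
      case True
      then have "s \<le> infdist x E" using assms(2) by (force simp: open_nbhd_def)
      then show ?thesis
        using True assms(3,4) unfolding dist_weight_def
        by (auto intro!: ennreal_leI powr_mono2')
    qed simp
  qed
  then show ?thesis using assms(1) by (simp add: emeasure_dist_measure nn_integral_cmult_indicator)
qed

lemma hole_le_radius:
  assumes "t \<in> hole_radii E x R"
  shows "t \<le> R"
proof -
  obtain y where "t > 0" "ball y t \<subseteq> ball x R" using assms by (auto simp: hole_radii_def)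
  then have "dist y x + t \<le> R" by (simp add: ball_subset_ball_iff)
  then show ?thesis by (smt (verit) zero_le_dist)
qed

lemma bdd_above_hole_radii: "bdd_above (hole_radii E x R)"
  using hole_le_radius by (intro bdd_aboveI)

lemma hole_le_max_hole: "t \<in> hole_radii E x R \<Longrightarrow> t \<le> max_hole E x R"
  unfolding max_hole_def using bdd_above_hole_radii by (auto intro: cSup_upper)

lemma max_hole_le_radius: "R > 0 \<Longrightarrow> max_hole E x R \<le> R"
  unfolding max_hole_def using hole_le_radius by (auto intro!: cSup_least)

text \<open>A point at positive distance from \<open>E\<close> is the centre of a hole; together with
  \<open>hole_le_max_hole\<close> this bounds the distance function by the size of the largest hole.\<close>

lemma hole_radiusI:
  assumes "0 < t" "t \<le> infdist y E" "dist x y + t \<le> R"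
  shows "t \<in> hole_radii E x R"
proof -
  have "ball y t \<inter> E = {}"
    using assms(2) infdist_le[of _ E y] by fastforce
  moreover have "ball y t \<subseteq> ball x R"
    using assms(1,3) by (simp add: ball_subset_ball_iff dist_commute)
  moreover have "y \<in> ball x R" using assms by simp
  ultimately show ?thesis using assms(1) unfolding hole_radii_def by blast
qed

lemma hole_centre:
  assumes "E \<noteq> {}" "t \<in> hole_radii E x R"
  obtains y where "y \<in> ball x R" "t \<le> infdist y E"
proof -
  obtain y where y: "y \<in> ball x R" "ball y t \<subseteq> ball x R - E"
    using assms(2) by (auto simp: hole_radii_def)
  then have "t \<le> infdist y E"
    unfolding infdist_notempty[OF assms(1)]
    by (intro cINF_greatest assms(1)) (force simp: not_less[symmetric])
  then show thesis using y that by blast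
qed

lemma ball_subset_cube: "ball x R \<subseteq> cube (x - (\<chi> i. R)) (2 * R)"
proof
  fix z assume z: "z \<in> ball x R"
  show "z \<in> cube (x - (\<chi> i. R)) (2 * R)"
    unfolding cube_def mem_Collect_eq
  proof
    fix i
    have "\<bar>(z - x) $ i\<bar> < R"
      using z component_le_norm_cart[of "z - x" i] by (simp add: dist_norm norm_minus_commute)
    then show "(x - (\<chi> i. R)) $ i \<le> z $ i \<and> z $ i < (x - (\<chi> i. R)) $ i + 2 * R"
      by auto
  qed
qed

lemma lebesgue_ball:
  fixes x :: "real ^ 'n"
  assumes "R > 0"
  shows "emeasure lebesgue (ball x R) = ennreal (unit_ball_vol CARD('n) * R ^ CARD('n))"
    and "measure lebesgue (ball x R) = unit_ball_vol CARD('n) * R ^ CARD('n)"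
proof -
  show e: "emeasure lebesgue (ball x R) = ennreal (unit_ball_vol CARD('n) * R ^ CARD('n))"
    using assms by (simp add: emeasure_ball)
  show "measure lebesgue (ball x R) = unit_ball_vol CARD('n) * R ^ CARD('n)"
    using e assms by (simp add: measure_def)
qed

lemma le_essinf_on:
  assumes "\<And>x. x \<in> Q \<Longrightarrow> c \<le> w x"
  shows "c \<le> essinf_on Q w"
  unfolding essinf_on_def using assms by (intro Sup_upper) simp

text \<open>If a ball had no hole, \<open>E\<close> would be dense in it and the weight would be infinite throughout the
  ball.\<close>

lemma max_hole_pos:
  fixes E :: "(real ^ 'n) set"
  assumes "locally_integrable (dist_weight E \<alpha>)" "\<alpha> > 0" "R > 0"
  shows "max_hole E x R > 0"
proof (rule ccontr)
  assume no: "\<not> max_hole E x R > 0"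
  have zero: "infdist y E = 0" if y: "y \<in> ball x R" for y
  proof (rule ccontr)
    assume "infdist y E \<noteq> 0"
    then have "infdist y E > 0" using infdist_nonneg[of y E] by simp
    then have "min (infdist y E) (R - dist x y) \<in> hole_radii E x R"
      using y by (intro hole_radiusI[of _ y]) auto
    then have "min (infdist y E) (R - dist x y) \<le> max_hole E x R" by (rule hole_le_max_hole)
    then show False using no y \<open>infdist y E > 0\<close> by auto
  qed
  have vol: "unit_ball_vol (real CARD('n)) \<noteq> 0"
    using less_imp_neq[OF unit_ball_vol_pos[of "real CARD('n)"]] by simp
  have "(\<integral>\<^sup>+z. \<infinity> * indicator (ball x R) z \<partial>lebesgue) \<le> (\<integral>\<^sup>+z\<in>cball x R. dist_weight E \<alpha> z \<partial>lebesgue)"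
    using zero assms(2) by (intro nn_integral_mono) (auto simp: dist_weight_def indicator_def)
  moreover have "(\<integral>\<^sup>+z. \<infinity> * indicator (ball x R) z \<partial>lebesgue) = \<infinity>"
    using assms(3) vol
    by (subst nn_integral_cmult_indicator) (auto simp: ennreal_top_mult lebesgue_ball(1) simp del: emeasure_completion)
  moreover have "(\<integral>\<^sup>+z\<in>cball x R. dist_weight E \<alpha> z \<partial>lebesgue) < \<infinity>"
    using assms(1) by (simp add: locally_integrable_def)
  ultimately show False by simp
qed

section \<open>Necessity\<close>

lemma dist_weight_neg_notin_A1:
  fixes E :: "(real ^ 'n) set"
  assumes "E \<noteq> {}" "\<alpha> < 0"
  shows "dist_weight E \<alpha> \<notin> A1"
proof
  assume A: "dist_weight E \<alpha> \<in> A1"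
  obtain e where e: "e \<in> E" using assms by blast
  define Q where "Q = cube e 1"
  have Q: "is_cube Q" "emeasure lebesgue Q = 1" "Q \<in> sets lebesgue"
    unfolding is_cube_iff Q_def using emeasure_cube[of 1 e] by (auto intro: zero_less_one)
  have "c = 0" if c: "AE x in lebesgue. x \<in> Q \<longrightarrow> c \<le> dist_weight E \<alpha> x" for c
  proof -
    have "c \<le> 0 + ennreal \<epsilon>" if "\<epsilon> > 0" for \<epsilon>
    proof -
      \<comment> \<open>On the cube of side \<open>s\<close> at \<open>e\<close> the distance to \<open>E\<close> is at most \<open>n s\<close>, and the weight at
        most \<open>\<epsilon>\<close>.\<close>
      define s where "s = min 1 (\<epsilon> powr (1 / - \<alpha>) / CARD('n))"
      have s: "s > 0" "s \<le> 1" using \<open>\<epsilon> > 0\<close> by (auto simp: s_def)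
      obtain z where z: "z \<in> cube e s" "z \<in> Q \<longrightarrow> c \<le> dist_weight E \<alpha> z"
        using AE_cube_ex[OF c s(1)] by blast
      have "z \<in> Q"
        using z(1) s(2) unfolding Q_def cube_def mem_Collect_eq by (smt (verit))
      have "e \<in> cube e s" using s by (simp add: cube_def)
      then have "infdist z E \<le> CARD('n) * s"
        using infdist_le[OF e, of z] cube_dist_le[OF z(1)] by force
      also have "\<dots> \<le> CARD('n) * (\<epsilon> powr (1 / - \<alpha>) / CARD('n))"
        unfolding s_def by (intro mult_left_mono) auto
      also have "\<dots> = \<epsilon> powr (1 / - \<alpha>)" by simp
      finally have "infdist z E powr (- \<alpha>) \<le> (\<epsilon> powr (1 / - \<alpha>)) powr (- \<alpha>)"
        using assms(2) infdist_nonneg by (intro powr_mono2) auto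
      also have "\<dots> = \<epsilon>" using assms(2) \<open>\<epsilon> > 0\<close> by (simp add: powr_powr)
      finally have "dist_weight E \<alpha> z \<le> ennreal \<epsilon>"
        using assms(2) by (auto simp: dist_weight_def intro: ennreal_leI)
      then show ?thesis using z \<open>z \<in> Q\<close> by simp
    qed
    then have "c \<le> 0" by (rule ennreal_le_epsilon)
    then show ?thesis by (simp only: le_zero_eq)
  qed
  then have "essinf_on Q (dist_weight E \<alpha>) \<le> 0"
    unfolding essinf_on_def by (intro Sup_least) simp
  then have "essinf_on Q (dist_weight E \<alpha>) = 0"
    by (simp only: le_zero_eq)
  moreover obtain C :: real where "(\<integral>\<^sup>+x\<in>Q. dist_weight E \<alpha> x \<partial>lebesgue) / emeasure lebesgue Q
      \<le> ennreal C * essinf_on Q (dist_weight E \<alpha>)"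
    using A Q(1) by (auto simp: A1_def)
  ultimately have "(\<integral>\<^sup>+x\<in>Q. dist_weight E \<alpha> x \<partial>lebesgue) = 0"
    by (simp add: Q(2))
  then have "AE x in lebesgue. dist_weight E \<alpha> x * indicator Q x = 0"
    using Q(3) by (subst (asm) nn_integral_0_iff_AE) auto
  moreover have "AE x in lebesgue. dist_weight E \<alpha> x > 0"
    using A by (simp add: A1_def weight_def)
  ultimately have "AE x in lebesgue. x \<notin> Q"
    by eventually_elim (auto simp: indicator_def split: if_splits)
  then show False
    using AE_cube_ex[of "\<lambda>x. x \<notin> Q" 1 e] by (auto simp: Q_def)
qed

text \<open>The form in which the \<open>A\<^sub>1\<close> condition is used: a single point far from \<open>E\<close> bounds the integral
  over the whole cube.\<close>

lemma A1_cube_bound: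
  fixes E :: "(real ^ 'n) set"
  assumes "dist_weight E \<alpha> \<in> A1" "\<alpha> > 0"
  obtains C where "C \<ge> 1"
    "\<And>a (l::real) y r. \<lbrakk>l > 0; y \<in> cube a l; 0 < r; r \<le> infdist y E\<rbrakk>
       \<Longrightarrow> emeasure (dist_measure E \<alpha>) (cube a l) \<le> ennreal (C * r powr (- \<alpha>) * l ^ CARD('n))"
proof -
  obtain C0 :: real where C0: "\<And>Q. is_cube Q \<Longrightarrow>
      (\<integral>\<^sup>+x\<in>Q. dist_weight E \<alpha> x \<partial>lebesgue) / emeasure lebesgue Q
        \<le> ennreal C0 * essinf_on Q (dist_weight E \<alpha>)"
    using assms by (auto simp: A1_def)
  define C where "C = max 1 (C0 * 2 powr \<alpha>)"
  have "emeasure (dist_measure E \<alpha>) (cube a l) \<le> ennreal (C * r powr (- \<alpha>) * l ^ CARD('n))"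
    if l: "l > 0" and y: "y \<in> cube a l" and r: "0 < r" "r \<le> infdist y E" for a :: "real ^ 'n" and l r y
  proof -
    let ?I = "emeasure (dist_measure E \<alpha>) (cube a l)" and ?L = "ennreal (l ^ CARD('n))"
    have L: "?L \<noteq> 0" "?L \<noteq> top" using l by auto
    have "?I / ?L \<le> ennreal C0 * essinf_on (cube a l) (dist_weight E \<alpha>)"
      using C0[of "cube a l"] l unfolding is_cube_iff emeasure_dist_measure[OF cube_lebesgue] emeasure_cube[OF l]
      by blast
    also have "\<dots> \<le> ennreal C0 * ennreal ((r / 2) powr (- \<alpha>))"
      by (intro mult_left_mono essinf_cube_le[OF assms(2) y r]) simp
    also have "\<dots> = ennreal (C0 * (r / 2) powr (- \<alpha>))"
      by (simp add: ennreal_mult'')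
    also have "\<dots> \<le> ennreal (C * r powr (- \<alpha>))"
    proof (rule ennreal_leI)
      have "C0 * (r / 2) powr (- \<alpha>) = (C0 * 2 powr \<alpha>) * r powr (- \<alpha>)"
        using r by (simp add: powr_divide powr_minus field_simps)
      also have "\<dots> \<le> C * r powr (- \<alpha>)"
        unfolding C_def by (intro mult_right_mono) auto
      finally show "C0 * (r / 2) powr (- \<alpha>) \<le> C * r powr (- \<alpha>)" .
    qed
    finally have "?I / ?L * ?L \<le> ennreal (C * r powr (- \<alpha>)) * ?L"
      by (rule mult_right_mono) simp
    moreover have "?I / ?L * ?L = ?I"
      using L by (metis ennreal_times_divide mult.commute mult_divide_eq_ennreal)
    ultimately show ?thesis
      using l by (simp add: ennreal_mult[symmetric] C_def)
  qed
  moreover have "C \<ge> 1" by (simp add: C_def)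
  ultimately show thesis using that by blast
qed

text \<open>
  The ball is enlarged to a cube, which contains the centre \<open>y\<close> of a nearly largest hole, of radius
  \<open>t\<close>. So the stopping-time estimate applies at every scale up to \<open>t\<close>, and the resulting decay from
  scale \<open>t\<close> down to scale \<open>r\<close> improves \<open>\<alpha>\<close> to \<open>\<alpha> + \<delta>\<close>.
\<close>

lemma A1_imp_larger_admissible:
  fixes E :: "(real ^ 'n) set"
  assumes A: "dist_weight E \<alpha> \<in> A1" and \<alpha>: "\<alpha> > 0" and ne: "E \<noteq> {}"
  obtains \<beta> where "\<beta> > \<alpha>" "Mu_admissible E \<beta>"
proof -
  obtain C where C: "C \<ge> 1"
    and bound: "\<And>a (l::real) y r. \<lbrakk>l > 0; y \<in> cube a l; 0 < r; r \<le> infdist y E\<rbrakk>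
       \<Longrightarrow> emeasure (dist_measure E \<alpha>) (cube a l) \<le> ennreal (C * r powr (- \<alpha>) * l ^ CARD('n))"
    using A1_cube_bound[OF A \<alpha>] by blast
  define M where "M = 2 ^ CARD('n) * C"
  have "1 * 1 \<le> M" unfolding M_def using C by (intro mult_mono) auto
  then have M: "M \<ge> 1" by simp
  obtain \<delta> c where \<delta>: "\<delta> > 0" and c: "c > 0"
    and decay: "\<And>V F s\<^sub>0 r. \<lbrakk>\<And>r s. 0 < r \<Longrightarrow> r \<le> s \<Longrightarrow> s \<le> s\<^sub>0 \<Longrightarrow> V r \<le> V s;
        \<And>r. 0 < r \<Longrightarrow> r \<le> s\<^sub>0 \<Longrightarrow> r powr (- \<alpha>) * V r \<le> F r;
        \<And>r s. 0 < r \<Longrightarrow> r \<le> s \<Longrightarrow> s \<le> s\<^sub>0 \<Longrightarrow> s powr (- \<alpha>) * (V s - V r) \<le> F s - F r;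
        \<And>s. 0 < s \<Longrightarrow> s \<le> s\<^sub>0 \<Longrightarrow> F s \<le> M * (s powr (- \<alpha>) * V s);
        0 \<le> F s\<^sub>0; 0 < r; r < s\<^sub>0\<rbrakk>
      \<Longrightarrow> F r \<le> c * (r / s\<^sub>0) powr \<delta> * (F s\<^sub>0 :: real)"
    using self_improving_decay[OF M \<alpha>] by blast
  define \<beta> where "\<beta> = \<alpha> + \<delta>"
  define \<omega> where "\<omega> = unit_ball_vol (CARD('n))"
  have \<omega>: "\<omega> > 0" by (simp add: \<omega>_def)
  define D where "D = c * M * 2 ^ CARD('n) / \<omega> * 2 powr \<beta>"
  have "measure lebesgue (open_nbhd E r \<inter> ball x R) / measure lebesgue (ball x R)
          \<le> D * (max_hole E x R / r) powr (- \<beta>)"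
    if x: "x \<in> E" and r: "0 < r" "r < max_hole E x R" and hR: "max_hole E x R \<le> R" for x r R
  proof -
    define h where "h = max_hole E x R"
    have R: "R > 0" using r hR by simp
    have "hole_radii E x R \<noteq> {}" "max_hole E x R = Sup (hole_radii E x R)"
      using r by (auto simp: max_hole_def split: if_splits)
    \<comment> \<open>The supremum need not be attained. A hole larger than \<open>r\<close> keeps \<open>r\<close> in the range of scales,
      and one larger than \<open>h / 2\<close> is comparable to the supremum.\<close>
    moreover have "max r (h / 2) < max_hole E x R" using r by (simp add: h_def)
    ultimately obtain t where t: "t \<in> hole_radii E x R" "r < t" "h / 2 < t"
      using less_cSup_iff[OF _ bdd_above_hole_radii, of E x R "max r (h / 2)"] by auto
    obtain y where y: "y \<in> ball x R" "t \<le> infdist y E"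
      using hole_centre[OF ne t(1)] .
    define a where "a = x - (\<chi> i. R)"
    define Q where "Q = cube a (2 * R)"
    have yQ: "y \<in> Q" using y ball_subset_cube[of x R] by (auto simp: Q_def a_def)
    have eQ: "emeasure lebesgue Q = ennreal ((2 * R) ^ CARD('n))"
      unfolding Q_def using R by (subst emeasure_cube) auto
    have mQ: "emeasure (dist_measure E \<alpha>) Q < top"
      using bound[of "2 * R" y a t] R yQ y t(2) r(1) unfolding Q_def
      by (auto intro: le_less_trans)
    have Q_sets: "Q \<inter> open_nbhd E s \<in> sets lebesgue" for s by (auto simp: Q_def)
    define V where "V s = measure lebesgue (Q \<inter> open_nbhd E s)" for s
    define F where "F s = measure (dist_measure E \<alpha>) (Q \<inter> open_nbhd E s)" for s
    have eV: "emeasure lebesgue (Q \<inter> open_nbhd E s) = ennreal (V s)" for s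
      unfolding V_def using Q_sets eQ emeasure_mono[of "Q \<inter> open_nbhd E s" Q lebesgue]
      by (intro emeasure_eq_ennreal_measure) (auto simp: Q_def top_unique)
    have eF: "emeasure (dist_measure E \<alpha>) (Q \<inter> open_nbhd E s) = ennreal (F s)" for s
      unfolding F_def using mQ emeasure_mono[of "Q \<inter> open_nbhd E s" Q "dist_measure E \<alpha>"]
      by (intro emeasure_eq_ennreal_measure) (auto simp: Q_def top_unique)
    have V0: "V s \<ge> 0" and F0: "F s \<ge> 0" for s by (simp_all add: V_def F_def)
    have incl: "Q \<inter> open_nbhd E p \<subseteq> Q \<inter> open_nbhd E q" if "p \<le> q" for p q
      using that by (auto simp: open_nbhd_def)
    have Vmono: "V p \<le> V q" if "p \<le> q" for p q
      using emeasure_mono[OF incl[OF that] Q_sets] V0 by (simp add: eV)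
    have lower: "s powr (- \<alpha>) * V s \<le> F s" if "s > 0" for s
      using dist_measure_ge[of "Q \<inter> open_nbhd E s" E s \<alpha>] that \<alpha> Q_sets F0
      by (simp add: eV eF ennreal_mult'[symmetric])
    have shell: "q powr (- \<alpha>) * (V q - V p) \<le> F q - F p" if "0 < p" "p \<le> q" for p q
    proof -
      let ?S = "Q \<inter> open_nbhd E q - Q \<inter> open_nbhd E p"
      have "emeasure lebesgue ?S = ennreal (V q - V p)"
        using Q_sets incl[OF that(2)] V0 by (subst emeasure_Diff) (auto simp: eV ennreal_minus)
      moreover have "emeasure (dist_measure E \<alpha>) ?S = ennreal (F q - F p)"
        using Q_sets incl[OF that(2)] F0 by (subst emeasure_Diff) (auto simp: eF ennreal_minus)
      moreover have "ennreal (q powr (- \<alpha>)) * emeasure lebesgue ?S \<le> emeasure (dist_measure E \<alpha>) ?S"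
        using Q_sets that \<alpha> by (intro dist_measure_ge) auto
      ultimately have le: "ennreal (q powr (- \<alpha>) * (V q - V p)) \<le> ennreal (F q - F p)"
        by (simp add: ennreal_mult')
      have "F p \<le> F q"
        using emeasure_mono[OF incl[OF that(2)], of "dist_measure E \<alpha>"] Q_sets F0 by (simp add: eF)
      then show ?thesis using le by (subst (asm) ennreal_le_iff) auto
    qed
    have upper: "F s \<le> M * (s powr (- \<alpha>) * V s)" if s: "0 < s" "s \<le> t" for s
    proof -
      have "emeasure (dist_measure E \<alpha>) (cube a (2 * R) \<inter> open_nbhd E s)
          \<le> ennreal (2 ^ CARD('n) * (C * s powr (- \<alpha>))) * emeasure lebesgue (cube a (2 * R) \<inter> open_nbhd E s)"
        by (rule level_set_bound[where y = y])
          (use bound s y yQ R C in \<open>auto simp: Q_def\<close>)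
      then have "ennreal (F s) \<le> ennreal (2 ^ CARD('n) * (C * s powr (- \<alpha>)) * V s)"
        using C by (simp add: Q_def[symmetric] eV eF ennreal_mult')
      then show ?thesis using C V0 by (subst (asm) ennreal_le_iff) (auto simp: M_def mult_ac)
    qed
    have "r powr (- \<alpha>) * V r \<le> F r" by (rule lower[OF r(1)])
    also have "F r \<le> c * (r / t) powr \<delta> * F t"
      by (rule decay[of t V F r]) (use Vmono lower shell upper F0 r t in auto)
    also have "\<dots> \<le> c * (r / t) powr \<delta> * (M * (t powr (- \<alpha>) * (2 * R) ^ CARD('n)))"
    proof (intro mult_left_mono)
      have "ennreal (V t) \<le> ennreal ((2 * R) ^ CARD('n))"
        unfolding eV[symmetric] eQ[symmetric] by (intro emeasure_mono) (auto simp: Q_def)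
      then have "V t \<le> (2 * R) ^ CARD('n)" using R by (subst (asm) ennreal_le_iff) auto
      then have "M * (t powr (- \<alpha>) * V t) \<le> M * (t powr (- \<alpha>) * (2 * R) ^ CARD('n))"
        using M by (intro mult_left_mono) auto
      then show "F t \<le> M * (t powr (- \<alpha>) * (2 * R) ^ CARD('n))"
        using upper[of t] r t by simp
    qed (use c in auto)
    finally have "V r \<le> r powr \<alpha> * (c * (r / t) powr \<delta> * (M * (t powr (- \<alpha>) * (2 * R) ^ CARD('n))))"
      using r(1) by (simp add: powr_minus field_simps)
    also have "\<dots> = c * M * 2 ^ CARD('n) * R ^ CARD('n) * (r / t) powr \<beta>"
      using r t by (simp add: \<beta>_def powr_add powr_divide powr_minus field_simps power_mult_distrib)
    also have "\<dots> \<le> c * M * 2 ^ CARD('n) * R ^ CARD('n) * (2 * (r / h)) powr \<beta>"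
      using c M R r t \<alpha> \<delta> by (intro mult_left_mono powr_mono2) (auto simp: \<beta>_def h_def field_simps)
    also have "(2 * (r / h)) powr \<beta> = 2 powr \<beta> * (h / r) powr (- \<beta>)"
      using r by (simp add: h_def powr_mult powr_minus powr_divide field_simps)
    finally have V: "V r \<le> D * (h / r) powr (- \<beta>) * (\<omega> * R ^ CARD('n))"
      using \<omega> by (simp add: D_def field_simps)
    have "ennreal (measure lebesgue (open_nbhd E r \<inter> ball x R)) \<le> ennreal (V r)"
    proof -
      have sub: "open_nbhd E r \<inter> ball x R \<subseteq> Q \<inter> open_nbhd E r"
        using ball_subset_cube[of x R] by (auto simp: Q_def a_def)
      have "emeasure lebesgue (open_nbhd E r \<inter> ball x R) \<le> emeasure lebesgue (Q \<inter> open_nbhd E r)"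
        by (intro emeasure_mono sub Q_sets)
      then show ?thesis
        unfolding eV by (subst emeasure_eq_ennreal_measure[symmetric]) (auto simp: top_unique)
    qed
    then have "measure lebesgue (open_nbhd E r \<inter> ball x R) \<le> V r" using V0 by simp
    then have "measure lebesgue (open_nbhd E r \<inter> ball x R) \<le> D * (h / r) powr (- \<beta>) * measure lebesgue (ball x R)"
      using V lebesgue_ball(2)[OF R, of x] by (simp add: \<omega>_def)
    moreover have "measure lebesgue (ball x R) > 0"
      using lebesgue_ball(2)[OF R, of x] \<omega> R by (simp add: \<omega>_def)
    ultimately show ?thesis by (simp add: h_def divide_le_eq)
  qed
  then have "Mu_admissible E \<beta>" unfolding Mu_admissible_def by blast
  then show thesis using that[of \<beta>] \<delta> by (simp add: \<beta>_def)
qed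

section \<open>Sufficiency\<close>

text \<open>
  At distance \<open>2\<^sup>-\<^sup>k h\<close> from \<open>E\<close> the weight is of order \<open>2\<^sup>k\<^sup>\<alpha> h\<^sup>-\<^sup>\<alpha>\<close>, whereas the
  neighbourhood of that radius fills at most a multiple of \<open>2\<^sup>-\<^sup>k\<^sup>\<beta>\<close> of the ball. The contributions
  of the shells therefore decay geometrically with ratio \<open>2\<^sup>\<alpha>\<^sup>-\<^sup>\<beta>\<close>, and the closure of \<open>E\<close> is
  a null set in the ball.
\<close>

lemma admissible_ball_bound:
  fixes E :: "(real ^ 'n) set"
  assumes \<alpha>: "0 < \<alpha>" "\<alpha> < \<beta>" and adm: "Mu_admissible E \<beta>"
  obtains D where "D > 0"
    "\<And>x R. \<lbrakk>x \<in> E; R > 0; max_hole E x R > 0\<rbrakk> \<Longrightarrow>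
       emeasure (dist_measure E \<alpha>) (ball x R)
         \<le> ennreal (D * max_hole E x R powr (- \<alpha>) * measure lebesgue (ball x R))"
proof -
  obtain C0 where C0: "\<And>x r R. x \<in> E \<Longrightarrow> 0 < r \<Longrightarrow> r < max_hole E x R \<Longrightarrow> max_hole E x R \<le> R \<Longrightarrow>
      measure lebesgue (open_nbhd E r \<inter> ball x R) / measure lebesgue (ball x R)
        \<le> C0 * (max_hole E x R / r) powr (- \<beta>)"
    using adm unfolding Mu_admissible_def by blast
  define C where "C = max 1 C0"
  have C: "C > 0" by (simp add: C_def)
  define q where "q = 2 powr (\<alpha> - \<beta>)"
  have q: "0 < q" "q < 1" using \<alpha> by (auto simp: q_def powr_less_one)
  define D where "D = 2 powr \<alpha> + C * 4 powr \<alpha> * 2 powr (- \<beta>) / (1 - q)"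
  have D: "D > 0" unfolding D_def using q C by (intro add_pos_nonneg) auto
  have "emeasure (dist_measure E \<alpha>) (ball x R)
         \<le> ennreal (D * max_hole E x R powr (- \<alpha>) * measure lebesgue (ball x R))"
    if x: "x \<in> E" and R: "R > 0" and h0: "max_hole E x R > 0" for x R
  proof -
    define h where "h = max_hole E x R"
    \<comment> \<open>Admissibility speaks of radii strictly below \<open>h\<close>, so the shells start at half of it.\<close>
    define s where "s = h / 2"
    have h: "h > 0" and s: "s > 0" using h0 by (auto simp: h_def s_def)
    let ?B = "ball x R" and ?\<mu> = "dist_measure E \<alpha>"
    define b where "b = measure lebesgue ?B"
    have b: "b > 0" "emeasure lebesgue ?B = ennreal b"
      unfolding b_def lebesgue_ball[OF R] using R by simp_all
    have small: "emeasure lebesgue (?B \<inter> open_nbhd E (s / 2 ^ k))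
        \<le> ennreal (C * b * 2 powr (- \<beta>) * (2 powr (- \<beta>)) ^ k)" for k
    proof -
      have le: "emeasure lebesgue (?B \<inter> open_nbhd E (s / 2 ^ k)) \<le> ennreal b"
        unfolding b(2)[symmetric] by (intro emeasure_mono) auto
      have "s / 2 ^ k \<le> s / 1" using s by (intro divide_left_mono) auto
      then have r: "0 < s / 2 ^ k" "s / 2 ^ k < h" using s by (auto simp: s_def)
      have "measure lebesgue (open_nbhd E (s / 2 ^ k) \<inter> ?B) / b \<le> C0 * (h / (s / 2 ^ k)) powr (- \<beta>)"
        using C0[OF x, of "s / 2 ^ k" R] r max_hole_le_radius[OF R, of E x] by (simp add: h_def b_def)
      also have "\<dots> \<le> C * (h / (s / 2 ^ k)) powr (- \<beta>)"
        unfolding C_def by (intro mult_right_mono) auto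
      also have "h / (s / 2 ^ k) = 2 ^ Suc k" using h by (simp add: s_def)
      also have "(2 ^ Suc k :: real) powr (- \<beta>) = 2 powr (- \<beta>) * (2 powr (- \<beta>)) ^ k"
        by (subst power_powr_swap) auto
      finally have "measure lebesgue (?B \<inter> open_nbhd E (s / 2 ^ k)) \<le> C * b * 2 powr (- \<beta>) * (2 powr (- \<beta>)) ^ k"
        using b(1) by (simp add: divide_le_eq Int_commute mult_ac)
      moreover have "emeasure lebesgue (?B \<inter> open_nbhd E (s / 2 ^ k))
          = ennreal (measure lebesgue (?B \<inter> open_nbhd E (s / 2 ^ k)))"
        using le by (intro emeasure_eq_ennreal_measure) (auto simp: top_unique)
      ultimately show ?thesis by (metis ennreal_leI)
    qed
    \<comment> \<open>\<open>A k\<close> is the \<open>k\<close>-th shell; \<open>Z\<close> is the part of the ball at distance zero.\<close>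
    define A where "A k = ?B \<inter> open_nbhd E (s / 2 ^ k) - open_nbhd E (s / 2 ^ Suc k)" for k
    define Z where "Z = ?B \<inter> (\<Inter>k. open_nbhd E (s / 2 ^ k))"
    have [simp]: "A k \<in> sets lebesgue" for k
      unfolding A_def by (intro sets.Diff sets.Int) auto
    have [simp]: "Z \<in> sets lebesgue" unfolding Z_def by (intro sets.Int sets.countable_INT) auto
    have [simp]: "?B - open_nbhd E s \<in> sets lebesgue" by (intro sets.Diff) auto
    have [simp]: "(\<Union>k. A k) \<in> sets lebesgue" by (intro sets.countable_UN) auto
    have "emeasure ?\<mu> Z = 0"
    proof -
      have "(\<lambda>k. C * b * 2 powr (- \<beta>) * (2 powr (- \<beta>)) ^ k) \<longlonglongrightarrow> C * b * 2 powr (- \<beta>) * 0"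
        using \<alpha> by (intro tendsto_intros LIMSEQ_power_zero) (auto simp: powr_less_one)
      then have "(\<lambda>k. ennreal (C * b * 2 powr (- \<beta>) * (2 powr (- \<beta>)) ^ k)) \<longlonglongrightarrow> ennreal 0"
        by (intro tendsto_ennrealI) simp
      moreover have "emeasure lebesgue Z \<le> ennreal (C * b * 2 powr (- \<beta>) * (2 powr (- \<beta>)) ^ k)" for k
        by (rule order_trans[OF emeasure_mono small]) (auto simp: Z_def)
      ultimately have "emeasure lebesgue Z \<le> ennreal 0"
        by (intro LIMSEQ_le_const) auto
      then have "Z \<in> null_sets lebesgue" by (simp add: null_sets_def)
      then show ?thesis
        by (simp add: emeasure_dist_measure nn_integral_null_set)
    qed
    define G where "G = C * 4 powr \<alpha> * 2 powr (- \<beta>) * h powr (- \<alpha>) * b"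
    have G: "G \<ge> 0" using C b by (simp add: G_def)
    have shell: "emeasure ?\<mu> (A k) \<le> ennreal (G * q ^ k)" for k
    proof -
      have "emeasure ?\<mu> (A k) \<le> ennreal ((s / 2 ^ Suc k) powr (- \<alpha>)) * emeasure lebesgue (A k)"
      proof (rule dist_measure_le)
        show "A k \<inter> open_nbhd E (s / 2 ^ Suc k) = {}" by (auto simp: A_def)
      qed (use s \<alpha> in auto)
      also have "\<dots> \<le> ennreal ((s / 2 ^ Suc k) powr (- \<alpha>)) * ennreal (C * b * 2 powr (- \<beta>) * (2 powr (- \<beta>)) ^ k)"
        by (intro mult_left_mono order_trans[OF emeasure_mono small]) (auto simp: A_def)
      also have "\<dots> = ennreal ((s / 2 ^ Suc k) powr (- \<alpha>) * (C * b * 2 powr (- \<beta>) * (2 powr (- \<beta>)) ^ k))"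
        using C b by (simp add: ennreal_mult)
      also have "(s / 2 ^ Suc k) powr (- \<alpha>) = 4 powr \<alpha> * h powr (- \<alpha>) * (2 powr \<alpha>) ^ k"
      proof -
        have "(s / 2 ^ Suc k) powr (- \<alpha>) = (h / (4 * 2 ^ k)) powr (- \<alpha>)" by (simp add: s_def)
        also have "\<dots> = 4 powr \<alpha> * h powr (- \<alpha>) * (2 powr \<alpha>) ^ k"
          using h power_powr_swap[of 2 k \<alpha>]
          by (simp add: powr_divide powr_mult powr_minus field_simps)
        finally show ?thesis .
      qed
      also have "4 powr \<alpha> * h powr (- \<alpha>) * (2 powr \<alpha>) ^ k * (C * b * 2 powr (- \<beta>) * (2 powr (- \<beta>)) ^ k)
          = G * (2 powr \<alpha> * 2 powr (- \<beta>)) ^ k"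
        by (simp add: G_def power_mult_distrib mult_ac)
      also have "2 powr \<alpha> * 2 powr (- \<beta>) = q"
        by (simp add: q_def powr_add[symmetric])
      finally show ?thesis .
    qed
    have "?B \<subseteq> (?B - open_nbhd E s) \<union> (Z \<union> (\<Union>k. A k))"
    proof
      fix z assume z: "z \<in> ?B"
      consider "infdist z E = 0" | "s \<le> infdist z E" | "0 < infdist z E" "infdist z E < s"
        using infdist_nonneg[of z E] by linarith
      then show "z \<in> (?B - open_nbhd E s) \<union> (Z \<union> (\<Union>k. A k))"
      proof cases
        case 1
        then show ?thesis using z s by (auto simp: Z_def open_nbhd_def)
      next
        case 2
        then show ?thesis using z by (auto simp: open_nbhd_def)
      next
        case 3
        then obtain k where "s / 2 ^ Suc k \<le> infdist z E" "infdist z E < s / 2 ^ k"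
          using geometric_bracket[of 2 "infdist z E" s] by auto
        then have "z \<in> A k" using z by (auto simp: A_def open_nbhd_def)
        then show ?thesis by blast
      qed
    qed
    then have "emeasure ?\<mu> ?B \<le> emeasure ?\<mu> ((?B - open_nbhd E s) \<union> (Z \<union> (\<Union>k. A k)))"
      by (intro emeasure_mono) (simp_all add: sets.Un)
    also have "\<dots> \<le> emeasure ?\<mu> (?B - open_nbhd E s) + emeasure ?\<mu> (Z \<union> (\<Union>k. A k))"
      by (intro emeasure_subadditive) (simp_all add: sets.Un)
    also have "\<dots> \<le> emeasure ?\<mu> (?B - open_nbhd E s) + (emeasure ?\<mu> Z + emeasure ?\<mu> (\<Union>k. A k))"
      by (intro add_left_mono emeasure_subadditive) simp_all
    also have "\<dots> = emeasure ?\<mu> (?B - open_nbhd E s) + emeasure ?\<mu> (\<Union>k. A k)"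
      using \<open>emeasure ?\<mu> Z = 0\<close> by simp
    also have "\<dots> \<le> ennreal (s powr (- \<alpha>) * b) + ennreal (G / (1 - q))"
    proof (rule add_mono)
      have "emeasure ?\<mu> (?B - open_nbhd E s) \<le> ennreal (s powr (- \<alpha>)) * emeasure lebesgue (?B - open_nbhd E s)"
        using s \<alpha> by (intro dist_measure_le) auto
      also have "\<dots> \<le> ennreal (s powr (- \<alpha>)) * emeasure lebesgue ?B"
        by (intro mult_left_mono emeasure_mono) auto
      finally show "emeasure ?\<mu> (?B - open_nbhd E s) \<le> ennreal (s powr (- \<alpha>) * b)"
        unfolding b(2) using b by (simp add: ennreal_mult)
      have "emeasure ?\<mu> (\<Union>k. A k) \<le> (\<Sum>k. emeasure ?\<mu> (A k))"
        by (intro emeasure_subadditive_countably) auto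
      also have "\<dots> \<le> (\<Sum>k. ennreal (G * q ^ k))"
        by (intro suminf_le shell) auto
      also have "\<dots> = ennreal (G * (1 / (1 - q)))"
        using G q by (intro suminf_ennreal_eq sums_mult geometric_sums) auto
      finally show "emeasure ?\<mu> (\<Union>k. A k) \<le> ennreal (G / (1 - q))" by simp
    qed
    also have "\<dots> = ennreal (s powr (- \<alpha>) * b + G / (1 - q))"
      using G q b by (intro ennreal_plus[symmetric]) auto
    also have "s powr (- \<alpha>) = 2 powr \<alpha> * h powr (- \<alpha>)"
      using h by (simp add: s_def powr_divide powr_minus field_simps)
    also have "2 powr \<alpha> * h powr (- \<alpha>) * b + G / (1 - q) = D * h powr (- \<alpha>) * b"
      by (simp add: D_def G_def algebra_simps)
    finally show ?thesis by (simp add: h_def b_def)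
  qed
  then show thesis using D that by blast
qed

text \<open>
  With \<open>d\<close> a bound for the diameter of the cube, there are two cases. If the cube comes closer than
  \<open>d\<close> to \<open>E\<close>, it lies in the ball of radius \<open>2 d\<close> around some \<open>e \<in> E\<close>, and its distances to \<open>E\<close>
  are realised by holes in the ball of radius \<open>4 d\<close>. Otherwise distances within the cube differ by
  at most a factor of two. In both cases a number \<open>m\<close> dominates the distance on the cube while the
  mean of \<open>w\<close> is at most \<open>C m\<^sup>-\<^sup>\<alpha>\<close>.
\<close>

lemma admissible_imp_A1:
  fixes E :: "(real ^ 'n) set"
  assumes ne: "E \<noteq> {}" and \<alpha>: "0 < \<alpha>" "\<alpha> < \<beta>" and adm: "Mu_admissible E \<beta>"
    and holes: "\<And>x R. x \<in> E \<Longrightarrow> R > 0 \<Longrightarrow> max_hole E x R > 0"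
  shows "dist_weight E \<alpha> \<in> A1"
proof -
  obtain D where D: "D > 0" and bound: "\<And>x R. \<lbrakk>x \<in> E; R > 0\<rbrakk> \<Longrightarrow>
       emeasure (dist_measure E \<alpha>) (ball x R)
         \<le> ennreal (D * max_hole E x R powr (- \<alpha>) * measure lebesgue (ball x R))"
    using admissible_ball_bound[OF \<alpha> adm] holes by metis
  have "(\<integral>\<^sup>+x\<in>K. dist_weight E \<alpha> x \<partial>lebesgue) < \<infinity>" if K: "compact K" for K
  proof -
    obtain e where e: "e \<in> E" using ne by blast
    obtain R where R: "R > 0" "K \<subseteq> ball e R"
      using bounded_subset_ballD[OF compact_imp_bounded[OF K]] by blast
    have [simp]: "K \<in> sets lebesgue" using K by (simp add: borel_compact)
    have "emeasure (dist_measure E \<alpha>) K \<le> emeasure (dist_measure E \<alpha>) (ball e R)"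
      using R by (intro emeasure_mono) auto
    also have "\<dots> < \<infinity>" using bound[OF e R(1)] by (auto intro: le_less_trans)
    finally show ?thesis by (simp add: emeasure_dist_measure)
  qed
  then have "locally_integrable (dist_weight E \<alpha>)"
    by (auto simp: locally_integrable_def)
  moreover have "dist_weight E \<alpha> x > 0" for x
    using infdist_nonneg[of x E] \<alpha>(1) by (auto simp: dist_weight_def)
  ultimately have w: "weight (dist_weight E \<alpha>)" by (simp add: weight_def)
  define N where "N = CARD('n)"
  define \<omega> where "\<omega> = unit_ball_vol N"
  have N: "N > 0" by (simp add: N_def)
  have \<omega>: "\<omega> > 0" by (simp add: \<omega>_def)
  \<comment> \<open>The two entries serve the cubes far from \<open>E\<close> and close to \<open>E\<close>, respectively; \<open>\<omega> (4 N)\<^sup>N\<close> is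
    the volume of a ball of radius \<open>4 d\<close> relative to that of the cube.\<close>
  define C where "C = max (4 powr \<alpha>) (D * \<omega> * (4 * N) ^ N)"
  have C: "C > 0" by (simp add: C_def less_max_iff_disj)
  have "(\<integral>\<^sup>+x\<in>Q. dist_weight E \<alpha> x \<partial>lebesgue) / emeasure lebesgue Q
          \<le> ennreal C * essinf_on Q (dist_weight E \<alpha>)" if "is_cube Q" for Q
  proof -
    obtain a l where l: "l > 0" and Q: "Q = cube a l" using \<open>is_cube Q\<close> by (auto simp: is_cube_iff)
    define d where "d = N * l"
    have d: "d > 0" using N l by (simp add: d_def)
    have diam: "dist x y \<le> d" if "x \<in> Q" "y \<in> Q" for x y
      using that cube_dist_le unfolding Q d_def N_def by blast
    have eQ: "emeasure lebesgue Q = ennreal (l ^ N)" unfolding Q N_def by (rule emeasure_cube[OF l])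
    have aQ: "a \<in> Q" using l by (simp add: Q cube_def)
    have Q_sets: "Q \<in> sets lebesgue" by (simp add: Q)
    have reduce: ?thesis
      if m: "m > 0" and up: "\<And>x. x \<in> Q \<Longrightarrow> infdist x E \<le> m"
        and int: "emeasure (dist_measure E \<alpha>) Q \<le> ennreal (C * m powr (- \<alpha>) * l ^ N)" for m
    proof -
      have "ennreal (m powr (- \<alpha>)) \<le> essinf_on Q (dist_weight E \<alpha>)"
      proof (rule le_essinf_on)
        fix x assume "x \<in> Q"
        then show "ennreal (m powr (- \<alpha>)) \<le> dist_weight E \<alpha> x"
          using up[of x] infdist_nonneg[of x E] \<alpha> unfolding dist_weight_def
          by (auto intro!: ennreal_leI powr_mono2')
      qed
      then have ess: "ennreal C * ennreal (m powr (- \<alpha>)) \<le> ennreal C * essinf_on Q (dist_weight E \<alpha>)"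
        by (intro mult_left_mono) auto
      have "(\<integral>\<^sup>+x\<in>Q. dist_weight E \<alpha> x \<partial>lebesgue) / emeasure lebesgue Q
          \<le> ennreal (C * m powr (- \<alpha>) * l ^ N) / ennreal (l ^ N)"
        unfolding eQ emeasure_dist_measure[OF Q_sets, symmetric] by (intro divide_right_mono_ennreal int)
      also have "\<dots> = ennreal C * ennreal (m powr (- \<alpha>))"
        using l C by (simp add: divide_ennreal ennreal_mult[symmetric])
      finally show ?thesis using ess by (rule order_trans)
    qed
    show ?thesis
    proof (cases "\<exists>x\<in>Q. infdist x E < d")
      case True
      then obtain x where x: "x \<in> Q" "infdist x E < d" by blast
      then obtain e where e: "e \<in> E" "dist x e < d"
        using ne unfolding infdist_notempty[OF ne] by (subst (asm) cINF_less_iff) auto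
      have near: "dist e y < 2 * d" if "y \<in> Q" for y
        using diam[OF that x(1)] e(2) dist_triangle[of e y x] by (simp add: dist_commute)
      let ?h = "max_hole E e (4 * d)"
      have h: "?h > 0" using holes e d by simp
      show ?thesis
      proof (rule reduce[OF h])
        fix y assume y: "y \<in> Q"
        show "infdist y E \<le> ?h"
        proof (cases "infdist y E = 0")
          case False
          then have "infdist y E > 0" using infdist_nonneg[of y E] by simp
          moreover have "dist e y + infdist y E \<le> 4 * d"
            using near[OF y] infdist_le[OF e(1), of y] by (simp add: dist_commute)
          ultimately show ?thesis by (intro hole_le_max_hole hole_radiusI) auto
        qed (use h in simp)
      next
        have "Q \<subseteq> ball e (4 * d)" using near d by force
        then have "emeasure (dist_measure E \<alpha>) Q \<le> emeasure (dist_measure E \<alpha>) (ball e (4 * d))"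
          by (intro emeasure_mono) auto
        also have "\<dots> \<le> ennreal (D * ?h powr (- \<alpha>) * measure lebesgue (ball e (4 * d)))"
          using e d by (intro bound) auto
        also have "\<dots> \<le> ennreal (C * ?h powr (- \<alpha>) * l ^ N)"
        proof (rule ennreal_leI)
          have "measure lebesgue (ball e (4 * d)) = \<omega> * (4 * N) ^ N * l ^ N"
            using d by (subst lebesgue_ball(2)) (auto simp: \<omega>_def N_def d_def power_mult_distrib)
          then have "D * ?h powr (- \<alpha>) * measure lebesgue (ball e (4 * d))
              = (D * \<omega> * (4 * N) ^ N) * ?h powr (- \<alpha>) * l ^ N" by (simp add: mult_ac)
          also have "\<dots> \<le> C * ?h powr (- \<alpha>) * l ^ N"
            unfolding C_def using l by (intro mult_right_mono) auto
          finally show "D * ?h powr (- \<alpha>) * measure lebesgue (ball e (4 * d)) \<le> C * ?h powr (- \<alpha>) * l ^ N" .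
        qed
        finally show "emeasure (dist_measure E \<alpha>) Q \<le> ennreal (C * ?h powr (- \<alpha>) * l ^ N)" .
      qed
    next
      case False
      then have far: "d \<le> infdist x E" if "x \<in> Q" for x using that by force
      define m where "m = infdist a E"
      have m: "m > 0" using far[OF aQ] d by (simp add: m_def)
      show ?thesis
      proof (rule reduce[of "2 * m"])
        fix x assume x: "x \<in> Q"
        show "infdist x E \<le> 2 * m"
          using infdist_triangle[of x E a] diam[OF x aQ] far[OF aQ] by (simp add: m_def)
      next
        have "Q \<inter> open_nbhd E (m / 2) = {}"
        proof (intro equals0I)
          fix x assume "x \<in> Q \<inter> open_nbhd E (m / 2)"
          then show False
            using infdist_triangle[of a E x] diam[OF aQ, of x] far[of x] by (simp add: m_def open_nbhd_def)
        qed
        then have "emeasure (dist_measure E \<alpha>) Q \<le> ennreal ((m / 2) powr (- \<alpha>)) * ennreal (l ^ N)"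
          unfolding eQ[symmetric] using m \<alpha> Q_sets by (intro dist_measure_le) auto
        also have "\<dots> = ennreal ((m / 2) powr (- \<alpha>) * l ^ N)" using l by (simp add: ennreal_mult)
        also have "\<dots> \<le> ennreal (C * (2 * m) powr (- \<alpha>) * l ^ N)"
        proof (intro ennreal_leI mult_right_mono)
          have "(4 :: real) powr \<alpha> = 2 powr \<alpha> * 2 powr \<alpha>" using powr_mult[of 2 2 \<alpha>] by simp
          then have "(m / 2) powr (- \<alpha>) = 4 powr \<alpha> * (2 * m) powr (- \<alpha>)"
            using m by (simp add: powr_divide powr_mult powr_minus field_simps)
          also have "\<dots> \<le> C * (2 * m) powr (- \<alpha>)" unfolding C_def by (intro mult_right_mono) auto
          finally show "(m / 2) powr (- \<alpha>) \<le> C * (2 * m) powr (- \<alpha>)" .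
        qed (use l in simp)
        finally show "emeasure (dist_measure E \<alpha>) Q \<le> ennreal (C * (2 * m) powr (- \<alpha>) * l ^ N)" .
      qed (use m in simp)
    qed
  qed
  then show ?thesis using w by (auto simp: A1_def)
qed

section \<open>The characterisation\<close>

theorem theorem1p3:
  fixes E :: "(real ^ 'n) set" and \<alpha> :: real
  assumes "E \<noteq> {}" and "\<alpha> \<noteq> 0"
  shows "dist_weight E \<alpha> \<in> A1 \<longleftrightarrow> 0 < \<alpha> \<and> ereal \<alpha> < Mu E"
proof
  assume A: "dist_weight E \<alpha> \<in> A1"
  then have \<alpha>: "0 < \<alpha>"
    using dist_weight_neg_notin_A1[OF assms(1), of \<alpha>] assms(2) by linarith
  have "locally_integrable (dist_weight E \<alpha>)" using A by (simp add: A1_def weight_def)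
  then have "max_hole E x R > 0" if "R > 0" for x R
    using max_hole_pos \<alpha> that by blast
  then have Mu: "Mu E = Sup (ereal ` {\<beta>. Mu_admissible E \<beta>})" by (simp add: Mu_def)
  obtain \<beta> where "\<beta> > \<alpha>" "Mu_admissible E \<beta>"
    using A1_imp_larger_admissible[OF A \<alpha> assms(1)] .
  then have "ereal \<alpha> < ereal \<beta>" "ereal \<beta> \<le> Mu E"
    unfolding Mu by (auto intro: Sup_upper)
  then have "ereal \<alpha> < Mu E" by (rule less_le_trans)
  then show "0 < \<alpha> \<and> ereal \<alpha> < Mu E" using \<alpha> by blast
next
  assume \<alpha>: "0 < \<alpha> \<and> ereal \<alpha> < Mu E"
  then have holes: "\<forall>x\<in>E. \<forall>R>0. max_hole E x R > 0"
    by (auto simp: Mu_def split: if_splits)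
  then have "ereal \<alpha> < Sup (ereal ` {\<beta>. Mu_admissible E \<beta>})"
    using \<alpha> by (simp add: Mu_def)
  then obtain \<beta> where "\<alpha> < \<beta>" "Mu_admissible E \<beta>"
    by (auto simp: less_Sup_iff)
  then show "dist_weight E \<alpha> \<in> A1"
    using admissible_imp_A1[OF assms(1)] \<alpha> holes by blast
qed

end
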